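(* Let $H>0$ and let $X=(X_t)_{t\geq0}$ be a one-dimensional, centered, $H$-self-similar Gaussian Markov process with covariance function $R(s,t)=\mathbb{E}[X_sX_t]$. Then there exist $c\in[-\infty,-H]$ such that \[ R(s,t)=R(1,1)\,R_{H,c}(s,t),\qquad s,t\geq0, \] with $R(1,1)\geq0$. Consequently $X$ has the same law as $R(1,1)^{1/2}X^{H,c}$.
   Context: A stochastic process $(X_t)_{t\geq0}$ is called $H$-self-similar with exponent $H>0$ if it is stochastically continuous at $0$ and, for every $a>0$, the process $(X_{at})_{t\geq0}$ has the same law as $(a^HX_t)_{t\geq0}$. For $H>0$ and finite $c\leq -H$, define \[ R_{H,c}(s,t)=\begin{cases}(s\vee t)^{2H+c}(s\wedge t)^{-c}, & s\wedge t>0,\\ 0,& s\wedge t=0,\end{cases} \] and define $R_{H,-\infty}(s,t)=\lim_{c\to-\infty}R_{H,c}(s,t)$, i.e. $R_{H,-\infty}(s,t)=t^{2H}$ if $s=t$ and $0$ if $s\neq t$. For $c\in[-\infty,-H]$, $X^{H,c}$ denotes a centered Gaussian process with covariance $R_{H,c}$; for finite $c\le -H$ it can be realized as $X^{H,c}_t=t^{2H+c}W(t^{-2H-2c})$ with $W$ a standard Brownian motion. *)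

theory Defs
  imports "HOL-Probability.Probability"
begin

definition gaussian_rv :: "'a measure \<Rightarrow> ('a \<Rightarrow> real) \<Rightarrow> bool" where
  "gaussian_rv M Y \<longleftrightarrow> Y \<in> borel_measurable M \<and>
     (\<exists>\<mu> \<sigma>. (\<sigma> = 0 \<and> distr M borel Y = return borel \<mu>) \<or>
            (\<sigma> > 0 \<and> distr M borel Y = density lborel (normal_density \<mu> \<sigma>)))"

definition gaussian_process :: "'a measure \<Rightarrow> (real \<Rightarrow> 'a \<Rightarrow> real) \<Rightarrow> bool" where
  "gaussian_process M X \<longleftrightarrow> prob_space M \<and> (\<forall>t\<ge>0. X t \<in> borel_measurable M) \<and>
     (\<forall>I a. finite I \<and> I \<subseteq> {0..} \<longrightarrow> gaussian_rv M (\<lambda>\<omega>. \<Sum>t\<in>I. a t * X t \<omega>))"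

definition centered :: "'a measure \<Rightarrow> (real \<Rightarrow> 'a \<Rightarrow> real) \<Rightarrow> bool" where
  "centered M X \<longleftrightarrow> (\<forall>t\<ge>0. integrable M (X t) \<and> (\<integral>\<omega>. X t \<omega> \<partial>M) = 0)"

definition covariance_fn :: "'a measure \<Rightarrow> (real \<Rightarrow> 'a \<Rightarrow> real) \<Rightarrow> real \<Rightarrow> real \<Rightarrow> real" where
  "covariance_fn M X s t = (\<integral>\<omega>. X s \<omega> * X t \<omega> \<partial>M)"

definition fdd :: "'a measure \<Rightarrow> (real \<Rightarrow> 'a \<Rightarrow> real) \<Rightarrow> real set \<Rightarrow> (real \<Rightarrow> real) measure" where
  "fdd M X I = distr M (PiM I (\<lambda>_. borel)) (\<lambda>\<omega>. \<lambda>t\<in>I. X t \<omega>)"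

definition same_law :: "'a measure \<Rightarrow> (real \<Rightarrow> 'a \<Rightarrow> real) \<Rightarrow> 'b measure \<Rightarrow> (real \<Rightarrow> 'b \<Rightarrow> real) \<Rightarrow> bool" where
  "same_law M X N Y \<longleftrightarrow> (\<forall>I. finite I \<and> I \<subseteq> {0..} \<longrightarrow> fdd M X I = fdd N Y I)"

definition self_similar :: "'a measure \<Rightarrow> real \<Rightarrow> (real \<Rightarrow> 'a \<Rightarrow> real) \<Rightarrow> bool" where
  "self_similar M H X \<longleftrightarrow>
     (\<forall>\<epsilon>>0. ((\<lambda>t. measure M {\<omega>\<in>space M. \<bar>X t \<omega> - X 0 \<omega>\<bar> > \<epsilon>}) \<longlongrightarrow> 0) (at_right 0)) \<and>
     (\<forall>a>0. same_law M (\<lambda>t. X (a * t)) M (\<lambda>t \<omega>. a powr H * X t \<omega>))"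

definition nat_filtration :: "'a measure \<Rightarrow> (real \<Rightarrow> 'a \<Rightarrow> real) \<Rightarrow> real \<Rightarrow> 'a measure" where
  "nat_filtration M X s = sigma (space M) (\<Union>u\<in>{0..s}. {X u -` A \<inter> space M | A. A \<in> sets borel})"

definition gen_by :: "'a measure \<Rightarrow> ('a \<Rightarrow> real) \<Rightarrow> 'a measure" where
  "gen_by M Y = sigma (space M) {Y -` A \<inter> space M | A. A \<in> sets borel}"

definition markov_process :: "'a measure \<Rightarrow> (real \<Rightarrow> 'a \<Rightarrow> real) \<Rightarrow> bool" where
  "markov_process M X \<longleftrightarrow> (\<forall>s t A. 0 \<le> s \<and> s \<le> t \<and> A \<in> sets borel \<longrightarrow>
     (AE \<omega> in M. real_cond_exp M (nat_filtration M X s) (\<lambda>\<omega>. indicator A (X t \<omega>)) \<omega> =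
                  real_cond_exp M (gen_by M (X s)) (\<lambda>\<omega>. indicator A (X t \<omega>)) \<omega>))"

definition R_Hc :: "real \<Rightarrow> ereal \<Rightarrow> real \<Rightarrow> real \<Rightarrow> real" where
  "R_Hc H c s t =
     (if c = -\<infinity> then (if s = t then t powr (2 * H) else 0)
      else if min s t > 0 then max s t powr (2 * H + real_of_ereal c) * min s t powr (- real_of_ereal c)
      else 0)"

end

theory Submission
  imports Defs
begin

text \<open>Self-similarity gives $R(as, at) = a^{2H} R(s, t)$, so $R$ is determined by
  $\rho(x) = R(1, x) / R(1, 1)$ for $x \geq 1$. If $s < t \leq u$, then $V = X_s - \gamma X_t$ with
  $\gamma = R(s, t) / R(t, t)$ satisfies $E[V \mid X_t] = 0$ by Gaussianity, and the Markov property
  turns this into $E[X_u V] = 0$, that is $R(s, u) R(t, t) = R(s, t) R(t, u)$. Hence $\rho$ is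
  multiplicative on $[1, \infty)$. By Cauchy--Schwarz it is bounded by $x^H$, so it is either a power
  $x^k$ with $k \leq H$ or vanishes on $(1, \infty)$; these cases are $c = k - 2H$ and $c = -\infty$.
  Equality in law follows from equality of covariances by the Cramer--Wold device.\<close>

subsection \<open>Multiplicative functions\<close>

text \<open>Two restrictions shape the proof. Nothing is known about the regularity of \<rho>, and
  the Markov identity needs ordered times, so multiplicativity holds only on the semigroup [1,
  \<infinity>). The Cauchy--Schwarz bound takes the place of continuity in the functional equation,
  and \<rho>(x) = \<rho>(sqrt x)^2 supplies the sign needed for taking logarithms. Secondly,
  \<open>gaussian_process\<close> speaks only of one-dimensional laws of linear combinations and
  \<open>markov_process\<close> only of indicators of the later variable. Joint laws are therefore
  recovered through characteristic functions, and the unbounded product X_u V is reached from the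
  products 1_A(X_u) V.\<close>

lemma multiplicative_eq_powr:
  fixes \<rho> :: "real \<Rightarrow> real"
  assumes mult: "\<And>x y. 1 \<le> x \<Longrightarrow> 1 \<le> y \<Longrightarrow> \<rho> (x * y) = \<rho> x * \<rho> y"
    and pos: "\<And>x. 1 \<le> x \<Longrightarrow> 0 < \<rho> x"
    and le: "\<And>x. 1 \<le> x \<Longrightarrow> \<rho> x \<le> x powr H"
  obtains k where "k \<le> H" "\<And>x. 1 \<le> x \<Longrightarrow> \<rho> x = x powr k"
proof -
  \<comment> \<open>In the variable y = ln x multiplicativity becomes Cauchy's equation. Taking the
    gap to the upper bound H y makes the additive function nonnegative, hence monotone.\<close>
  define h where "h y = H * y - ln (\<rho> (exp y))" for y
  have h_add: "h (x + y) = h x + h y" if "0 \<le> x" "0 \<le> y" for x y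
    using that mult[of "exp x" "exp y"] pos[of "exp x"] pos[of "exp y"]
    by (simp add: h_def exp_add ln_mult algebra_simps)
  have h_nonneg: "0 \<le> h y" if "0 \<le> y" for y
  proof -
    have "ln (\<rho> (exp y)) \<le> ln (exp y powr H)"
      using that le[of "exp y"] pos[of "exp y"] by (intro ln_mono) auto
    then show ?thesis by (simp add: h_def ln_powr)
  qed
  have h_mono: "h x \<le> h y" if "0 \<le> x" "x \<le> y" for x y
    using h_add[of x "y - x"] h_nonneg[of "y - x"] that by simp
  have h_mult: "h (real n * y) = real n * h y" if "0 \<le> y" for n y
  proof (induction n)
    case 0
    show ?case using h_add[of 0 0] by simp
  next
    case (Suc n)
    then show ?case using h_add[of "real n * y" y] that by (simp add: algebra_simps)
  qed
  have h_lin: "h y = y * h 1" if "0 \<le> y" for y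
  proof -
    \<comment> \<open>Both n h(y) and n y h(1) lie between m h(1) and (m + 1) h(1), where m is the
      integer part of n y. The bound does not depend on n, so the difference must vanish.\<close>
    have bd: "real n * \<bar>h y - y * h 1\<bar> \<le> h 1" for n
    proof -
      define m where "m = nat \<lfloor>real n * y\<rfloor>"
      have m: "real m \<le> real n * y" "real n * y \<le> real (Suc m)"
        using that unfolding m_def by (auto simp: of_nat_nat) linarith+
      have 1: "real m * h 1 \<le> real n * h y" "real n * h y \<le> real (Suc m) * h 1"
        using h_mono[OF _ m(1)] h_mono[OF _ m(2)] h_mult[of 1 m] h_mult[of 1 "Suc m"] h_mult[of y n] that
        by auto
      have 2: "real m * h 1 \<le> real n * y * h 1" "real n * y * h 1 \<le> real (Suc m) * h 1"
        using m h_nonneg[of 1] by (auto intro!: mult_right_mono)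
      have "real n * \<bar>h y - y * h 1\<bar> = \<bar>real n * (h y - y * h 1)\<bar>"
        by (simp add: abs_mult)
      also have "\<dots> = \<bar>real n * h y - real n * y * h 1\<bar>"
        by (simp add: right_diff_distrib mult.assoc)
      also have "\<dots> \<le> h 1" using 1 2 by (auto simp: algebra_simps abs_le_iff)
      finally show ?thesis .
    qed
    show ?thesis
    proof (rule ccontr)
      assume "h y \<noteq> y * h 1"
      then obtain n :: nat where "h 1 < real n * \<bar>h y - y * h 1\<bar>"
        using reals_Archimedean3[of "\<bar>h y - y * h 1\<bar>"] by auto
      then show False using bd[of n] by simp
    qed
  qed
  show ?thesis
  proof (rule that[of "H - h 1"])
    show "H - h 1 \<le> H" using h_nonneg[of 1] by simp
    fix x :: real assume x: "1 \<le> x"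
    then have "ln (\<rho> x) = (H - h 1) * ln x"
      using h_lin[of "ln x"] by (simp add: h_def algebra_simps)
    then have "exp (ln (\<rho> x)) = x powr (H - h 1)"
      using x by (simp add: powr_def)
    then show "\<rho> x = x powr (H - h 1)" using pos[OF x] by simp
  qed
qed

subsection \<open>The Cramer--Wold device\<close>

text \<open>Reduction to Levy's uniqueness theorem for probability measures: the total mass is the
  value of \<open>char\<close> at 0, so both measures are normalised by the same constant, and mass
  0 is treated apart. Finite measures are needed because the laws below carry weights.\<close>

lemma finite_borel_measure_eqI_char:
  assumes M: "finite_measure M" "sets M = sets borel"
    and N: "finite_measure N" "sets N = sets borel"
    and char: "char M = char N"
  shows "M = N"
proof -
  interpret M: finite_measure M by fact
  interpret N: finite_measure N by fact
  note [measurable_cong] = M(2) N(2)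
  define m where "m = measure M (space M)"
  have "complex_of_real (measure M (space M)) = complex_of_real (measure N (space N))"
    using fun_cong[OF char, of 0] by (simp add: char_def scaleR_conv_of_real)
  then have mN: "m = measure N (space N)" by (simp add: m_def)
  show ?thesis
  proof (cases "m = 0")
    case True
    have "emeasure M A = emeasure N A" for A
    proof -
      have "emeasure M A \<le> emeasure M (space M)" "emeasure N A \<le> emeasure N (space N)"
        by (auto intro: emeasure_space)
      then show ?thesis
        using True mN by (simp add: m_def M.emeasure_eq_measure N.emeasure_eq_measure measure_le_0_iff)
    qed
    then show ?thesis using M(2) N(2) by (intro measure_eqI) auto
  next
    case False
    then have m: "0 < m" using measure_nonneg[of M "space M"] unfolding m_def by linarith
    define P where "P K = density K (\<lambda>_. ennreal (1 / m))" for K :: "real measure"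
    have P: "real_distribution (P K)" "char (P K) t = (1 / m) *\<^sub>R char K t"
      if K: "finite_measure K" "sets K = sets borel" "measure K (space K) = m" for K t
    proof -
      interpret K: finite_measure K by fact
      note [measurable_cong] = K(2)
      have "emeasure (P K) (space (P K)) = 1"
        using K(3) m by (simp add: P_def emeasure_density_const K.emeasure_eq_measure flip: ennreal_mult)
      then show "real_distribution (P K)"
        using K(2) by (auto simp: real_distribution_def real_distribution_axioms_def P_def intro!: prob_spaceI)
      show "char (P K) t = (1 / m) *\<^sub>R char K t"
        unfolding char_def P_def using m by (subst integral_density) auto
    qed
    have "P M = P N"
    proof (rule Levy_uniqueness)
      show "char (P M) = char (P N)"
        using P(2)[OF M m_def[symmetric]] P(2)[OF N mN[symmetric]] char by (simp add: fun_eq_iff)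
    qed (use P(1)[OF M m_def[symmetric]] P(1)[OF N mN[symmetric]] in auto)
    moreover have "density (P K) (\<lambda>_. ennreal m) = K" for K
      using m by (simp add: P_def density_density_eq density_1 flip: ennreal_mult)
    ultimately show ?thesis by metis
  qed
qed

lemma finite_measure_density_integrable:
  fixes w :: "'a \<Rightarrow> real"
  assumes w: "integrable M w" "\<And>x. 0 \<le> w x"
  shows "finite_measure (density M w)"
proof -
  have "emeasure (density M w) (space M) = ennreal (LINT x|M. w x)"
    using w by (subst emeasure_density) (auto simp: nn_integral_eq_integral cong: nn_integral_cong)
  then show ?thesis by (intro finite_measureI) auto
qed

text \<open>The hypothesis \<open>eq\<close> equates the characteristic functions of the two
  weighted laws. The weights act as densities, which is why they must be nonnegative.\<close>

lemma distr_density_eqI_iexp: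
  fixes w :: "'a \<Rightarrow> real" and v :: "'b \<Rightarrow> real"
  assumes [measurable]: "X \<in> borel_measurable M" "Y \<in> borel_measurable N"
    and w: "integrable M w" "\<And>x. 0 \<le> w x"
    and v: "integrable N v" "\<And>x. 0 \<le> v x"
    and eq: "\<And>u. (CLINT x|M. w x *\<^sub>R iexp (u * X x)) = (CLINT x|N. v x *\<^sub>R iexp (u * Y x))"
  shows "distr (density M w) borel X = distr (density N v) borel Y"
proof (rule finite_borel_measure_eqI_char)
  have [measurable]: "w \<in> borel_measurable M" "v \<in> borel_measurable N"
    using w v by auto
  show "finite_measure (distr (density M w) borel X)" "finite_measure (distr (density N v) borel Y)"
    using w v by (auto intro!: finite_measure.finite_measure_distr finite_measure_density_integrable)
  show "char (distr (density M w) borel X) = char (distr (density N v) borel Y)"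
    using eq w(2) v(2) by (simp add: fun_eq_iff char_def integral_distr integral_density)
qed auto

lemma integral_indicator_eqI_iexp:
  fixes w :: "'a \<Rightarrow> real" and v :: "'b \<Rightarrow> real"
  assumes [measurable]: "X \<in> borel_measurable M" "Y \<in> borel_measurable N"
    and w: "integrable M w" "\<And>x. 0 \<le> w x"
    and v: "integrable N v" "\<And>x. 0 \<le> v x"
    and eq: "\<And>u. (CLINT x|M. w x *\<^sub>R iexp (u * X x)) = (CLINT x|N. v x *\<^sub>R iexp (u * Y x))"
    and A [measurable]: "A \<in> sets borel"
  shows "(LINT x|M. w x * indicator A (X x)) = (LINT x|N. v x * indicator A (Y x))"
proof -
  have [measurable]: "w \<in> borel_measurable M" "v \<in> borel_measurable N"
    using w v by auto
  have "(LINT y|distr (density M w) borel X. indicat_real A y) = (LINT x|M. w x * indicator A (X x))"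
    using w(2) by (subst integral_distr) (auto simp: integral_density)
  moreover have "(LINT y|distr (density N v) borel Y. indicat_real A y) = (LINT x|N. v x * indicator A (Y x))"
    using v(2) by (subst integral_distr) (auto simp: integral_density)
  ultimately show ?thesis
    using distr_density_eqI_iexp[OF assms(1-7)] by simp
qed

text \<open>The coordinates are treated one at a time: with $L$ a linear form in the others, uniqueness of
  characteristic functions is applied to the law of $X_j$ under the nonnegative weights $1$,
  $1 + \cos L$ and $1 + \sin L$. This gives $E[1_A(X_j) e^{iL}]$, which is the hypothesis for the
  restricted measure and one coordinate less.\<close>

lemma measure_rectangle_eqI_iexp:
  fixes M :: "'a measure" and N :: "'b measure"
  assumes "finite I" "finite_measure M" "finite_measure N"
    and "\<And>i. i \<in> I \<Longrightarrow> X i \<in> borel_measurable M"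
    and "\<And>i. i \<in> I \<Longrightarrow> Y i \<in> borel_measurable N"
    and "\<And>a. (CLINT x|M. iexp (\<Sum>i\<in>I. a i * X i x)) = (CLINT x|N. iexp (\<Sum>i\<in>I. a i * Y i x))"
    and "\<And>i. i \<in> I \<Longrightarrow> A i \<in> sets borel"
  shows "measure M {x\<in>space M. \<forall>i\<in>I. X i x \<in> A i} = measure N {x\<in>space N. \<forall>i\<in>I. Y i x \<in> A i}"
  using assms
proof (induction I arbitrary: M N rule: finite_induct)
  case empty
  then interpret M: finite_measure M + N: finite_measure N by auto
  \<comment> \<open>Without coordinates the integrand is 1, and the hypothesis is the equality of
    the total masses.\<close>
  show ?case using empty(5) by (simp add: scaleR_conv_of_real)
next
  case (insert j I)
  interpret M: finite_measure M by fact
  interpret N: finite_measure N by fact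
  have [measurable]: "X i \<in> borel_measurable M" "Y i \<in> borel_measurable N" "A i \<in> sets borel"
    if "i \<in> I" for i using insert.prems that by auto
  have [measurable]: "X j \<in> borel_measurable M" "Y j \<in> borel_measurable N" "A j \<in> sets borel"
    using insert.prems by auto
  define LX where "LX a x = (\<Sum>i\<in>I. a i * X i x)" for a x
  define LY where "LY a x = (\<Sum>i\<in>I. a i * Y i x)" for a x
  have [measurable]: "LX a \<in> borel_measurable M" "LY a \<in> borel_measurable N" for a
    unfolding LX_def LY_def by (auto intro!: borel_measurable_sum borel_measurable_times insert.prems)
  have iM: "integrable M (\<lambda>x. iexp (f x))" if [measurable]: "f \<in> borel_measurable M" for f
    by (rule M.integrable_const_bound[where B=1]) (simp, measurable)
  have iN: "integrable N (\<lambda>x. iexp (f x))" if [measurable]: "f \<in> borel_measurable N" for f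
    by (rule N.integrable_const_bound[where B=1]) (simp, measurable)
  \<comment> \<open>The extra factor b gives access to the forms 0, L and -L, the ones that occur in
    Euler's formulas.\<close>
  have eq: "(CLINT x|M. iexp (u * X j x + b * LX a x)) = (CLINT x|N. iexp (u * Y j x + b * LY a x))" for u b a
  proof -
    define a' where "a' = (\<lambda>i. if i = j then u else b * a i)"
    have "(\<Sum>i\<in>insert j I. a' i * X i x) = u * X j x + b * LX a x" for x
      using insert.hyps by (auto simp: a'_def LX_def sum_distrib_left algebra_simps intro!: sum.cong)
    moreover have "(\<Sum>i\<in>insert j I. a' i * Y i x) = u * Y j x + b * LY a x" for x
      using insert.hyps by (auto simp: a'_def LY_def sum_distrib_left algebra_simps intro!: sum.cong)
    ultimately show ?thesis using insert.prems(5)[of a'] by simp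
  qed
  define eX where "eX u b a x = iexp (u * X j x + b * LX a x)" for u b a x
  define eY where "eY u b a x = iexp (u * Y j x + b * LY a x)" for u b a x
  have e: "integrable M (eX u b a)" "integrable N (eY u b a)" "(CLINT x|M. eX u b a x) = (CLINT x|N. eY u b a x)" for u b a
    unfolding eX_def[abs_def] eY_def[abs_def] by (rule iM iN eq, measurable)+
  have E1: "(LINT x|M. indicator (A j) (X j x)) = (LINT x|N. indicat_real (A j) (Y j x))"
    using integral_indicator_eqI_iexp[of "X j" M "Y j" N "\<lambda>_. 1" "\<lambda>_. 1" "A j"] eq[of _ 0] by simp
  \<comment> \<open>Euler's formulas, with the summands \<open>0 * l\<close>, \<open>1 * l\<close>
    and \<open>(-1) * l\<close> left unsimplified so that they match \<open>eX\<close> and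
    \<open>eY\<close> at b = 0, 1, -1.\<close>
  have cosid: "(1 + cos l) *\<^sub>R iexp (u * y) =
      iexp (u * y + 0 * l) + (iexp (u * y + 1 * l) + iexp (u * y + (-1) * l)) / 2" for l u y :: real
    unfolding cis_conv_exp[symmetric]
    by (simp add: complex_eq_iff cos_add sin_add cos_diff sin_diff) (simp add: algebra_simps)
  have sinid: "(1 + sin l) *\<^sub>R iexp (u * y) =
      iexp (u * y + 0 * l) + (iexp (u * y + 1 * l) - iexp (u * y + (-1) * l)) * (- \<i> / 2)" for l u y :: real
    unfolding cis_conv_exp[symmetric]
    by (simp add: complex_eq_iff cos_add sin_add cos_diff sin_diff) (simp add: algebra_simps)
  have b: "\<bar>1 + cos l\<bar> \<le> 2" "\<bar>1 + sin l\<bar> \<le> 2" for l :: real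
    using cos_ge_minus_one[of l] cos_le_one[of l] sin_ge_minus_one[of l] sin_le_one[of l] by linarith+
  have Ec: "(LINT x|M. (1 + cos (LX a x)) * indicator (A j) (X j x)) =
      (LINT x|N. (1 + cos (LY a x)) * indicator (A j) (Y j x))" for a
  proof (rule integral_indicator_eqI_iexp)
    show "integrable M (\<lambda>x. 1 + cos (LX a x))" "integrable N (\<lambda>x. 1 + cos (LY a x))"
      using b by (auto intro!: M.integrable_const_bound[where B=2] N.integrable_const_bound[where B=2])
    show "0 \<le> 1 + cos (LX a x)" "0 \<le> 1 + cos (LY a y)" for x y
      using cos_ge_minus_one[of "LX a x"] cos_ge_minus_one[of "LY a y"] by linarith+
    show "(CLINT x|M. (1 + cos (LX a x)) *\<^sub>R iexp (u * X j x)) =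
      (CLINT x|N. (1 + cos (LY a x)) *\<^sub>R iexp (u * Y j x))" for u
      unfolding cosid unfolding eX_def[symmetric] eY_def[symmetric] using e by simp
  qed auto
  have Es: "(LINT x|M. (1 + sin (LX a x)) * indicator (A j) (X j x)) =
      (LINT x|N. (1 + sin (LY a x)) * indicator (A j) (Y j x))" for a
  proof (rule integral_indicator_eqI_iexp)
    show "integrable M (\<lambda>x. 1 + sin (LX a x))" "integrable N (\<lambda>x. 1 + sin (LY a x))"
      using b by (auto intro!: M.integrable_const_bound[where B=2] N.integrable_const_bound[where B=2])
    show "0 \<le> 1 + sin (LX a x)" "0 \<le> 1 + sin (LY a y)" for x y
      using sin_ge_minus_one[of "LX a x"] sin_ge_minus_one[of "LY a y"] by linarith+
    show "(CLINT x|M. (1 + sin (LX a x)) *\<^sub>R iexp (u * X j x)) =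
      (CLINT x|N. (1 + sin (LY a x)) *\<^sub>R iexp (u * Y j x))" for u
      unfolding sinid unfolding eX_def[symmetric] eY_def[symmetric] using e by simp
  qed auto
  \<comment> \<open>Restriction to the event that coordinate j lies in A_j. Mass may be lost, so the
    induction ranges over finite measures.\<close>
  define M1 where "M1 = density M (\<lambda>x. ennreal (indicator (A j) (X j x)))"
  define N1 where "N1 = density N (\<lambda>x. ennreal (indicator (A j) (Y j x)))"
  \<comment> \<open>Subtracting the integral for weight 1 from those for 1 + cos L and 1 + sin L
    leaves the real and imaginary parts.\<close>
  have split: "indicat_real B y *\<^sub>R iexp l =
      of_real ((1 + cos l) * indicat_real B y - indicat_real B y)
      + \<i> * of_real ((1 + sin l) * indicat_real B y - indicat_real B y)" for B and y l :: real
    unfolding cis_conv_exp[symmetric] by (simp add: complex_eq_iff algebra_simps)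
  have ball_ins: "(\<forall>i\<in>insert j I. P i) \<longleftrightarrow> P j \<and> (\<forall>i\<in>I. P i)" for P
    by blast
  have "measure M1 {x\<in>space M1. \<forall>i\<in>I. X i x \<in> A i} = measure N1 {x\<in>space N1. \<forall>i\<in>I. Y i x \<in> A i}"
  proof (rule insert.IH)
    show "finite_measure M1" "finite_measure N1"
      unfolding M1_def N1_def
      by (auto intro!: finite_measure_density_integrable M.integrable_const_bound[where B=1]
          N.integrable_const_bound[where B=1])
    fix a
    have intM: "integrable M (\<lambda>x. f x * indicat_real (A j) (X j x))"
      if "f \<in> borel_measurable M" "\<And>x. \<bar>f x\<bar> \<le> 2" for f
      using that by (intro M.integrable_const_bound[where B=2]) (auto simp: abs_mult split: split_indicator)
    have intN: "integrable N (\<lambda>x. f x * indicat_real (A j) (Y j x))"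
      if "f \<in> borel_measurable N" "\<And>x. \<bar>f x\<bar> \<le> 2" for f
      using that by (intro N.integrable_const_bound[where B=2]) (auto simp: abs_mult split: split_indicator)
    have "(CLINT x|M. indicat_real (A j) (X j x) *\<^sub>R iexp (LX a x)) =
        (CLINT x|N. indicat_real (A j) (Y j x) *\<^sub>R iexp (LY a x))"
      unfolding split
      using intM[of "\<lambda>x. 1 + cos (LX a x)"] intM[of "\<lambda>x. 1 + sin (LX a x)"] intM[of "\<lambda>x. 1"]
        intN[of "\<lambda>x. 1 + cos (LY a x)"] intN[of "\<lambda>x. 1 + sin (LY a x)"] intN[of "\<lambda>x. 1"] b E1 Ec[of a] Es[of a]
      by (simp del: of_real_mult of_real_diff of_real_add)
    then show "(CLINT x|M1. iexp (\<Sum>i\<in>I. a i * X i x)) = (CLINT x|N1. iexp (\<Sum>i\<in>I. a i * Y i x))"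
      unfolding LX_def[symmetric] LY_def[symmetric] M1_def N1_def by (simp add: integral_density)
  qed (auto simp: M1_def N1_def)
  moreover have "measure M1 {x\<in>space M1. \<forall>i\<in>I. X i x \<in> A i} = measure M {x\<in>space M. \<forall>i\<in>insert j I. X i x \<in> A i}"
  proof -
    have [measurable]: "{x\<in>space M. \<forall>i\<in>I. X i x \<in> A i} \<in> sets M"
       "{x\<in>space M. \<forall>i\<in>insert j I. X i x \<in> A i} \<in> sets M"
      using insert.hyps unfolding ball_ins by measurable
    have "emeasure M1 {x\<in>space M1. \<forall>i\<in>I. X i x \<in> A i} =
        (\<integral>\<^sup>+x. ennreal (indicat_real (A j) (X j x)) * indicator {x\<in>space M. \<forall>i\<in>I. X i x \<in> A i} x \<partial>M)"
      unfolding M1_def by (simp add: emeasure_density)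
    also have "\<dots> = (\<integral>\<^sup>+x. indicator {x\<in>space M. \<forall>i\<in>insert j I. X i x \<in> A i} x \<partial>M)"
      by (intro nn_integral_cong) (auto split: split_indicator)
    also have "\<dots> = emeasure M {x\<in>space M. \<forall>i\<in>insert j I. X i x \<in> A i}"
      by (intro nn_integral_indicator) measurable
    finally show ?thesis by (simp add: measure_def)
  qed
  moreover have "measure N1 {x\<in>space N1. \<forall>i\<in>I. Y i x \<in> A i} = measure N {x\<in>space N. \<forall>i\<in>insert j I. Y i x \<in> A i}"
  proof -
    have [measurable]: "{x\<in>space N. \<forall>i\<in>I. Y i x \<in> A i} \<in> sets N"
       "{x\<in>space N. \<forall>i\<in>insert j I. Y i x \<in> A i} \<in> sets N"
      using insert.hyps unfolding ball_ins by measurable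
    have "emeasure N1 {x\<in>space N1. \<forall>i\<in>I. Y i x \<in> A i} =
        (\<integral>\<^sup>+x. ennreal (indicat_real (A j) (Y j x)) * indicator {x\<in>space N. \<forall>i\<in>I. Y i x \<in> A i} x \<partial>N)"
      unfolding N1_def by (simp add: emeasure_density)
    also have "\<dots> = (\<integral>\<^sup>+x. indicator {x\<in>space N. \<forall>i\<in>insert j I. Y i x \<in> A i} x \<partial>N)"
      by (intro nn_integral_cong) (auto split: split_indicator)
    also have "\<dots> = emeasure N {x\<in>space N. \<forall>i\<in>insert j I. Y i x \<in> A i}"
      by (intro nn_integral_indicator) measurable
    finally show ?thesis by (simp add: measure_def)
  qed
  ultimately show ?case by simp
qed

text \<open>The laws of the linear combinations determine the integrals of \<open>iexp\<close>,
  these determine the measures of rectangles, and the rectangles generate the product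
  sigma-algebra.\<close>

theorem cramer_wold:
  fixes M :: "'a measure" and N :: "'b measure"
  assumes I: "finite I" and M: "prob_space M" and N: "prob_space N"
    and X: "\<And>i. i \<in> I \<Longrightarrow> X i \<in> borel_measurable M"
    and Y: "\<And>i. i \<in> I \<Longrightarrow> Y i \<in> borel_measurable N"
    and eq: "\<And>a. distr M borel (\<lambda>x. \<Sum>i\<in>I. a i * X i x) = distr N borel (\<lambda>x. \<Sum>i\<in>I. a i * (Y i x :: real))"
  shows "distr M (PiM I (\<lambda>_. borel)) (\<lambda>x. \<lambda>i\<in>I. X i x) = distr N (PiM I (\<lambda>_. borel)) (\<lambda>x. \<lambda>i\<in>I. Y i x)"
    (is "?P = ?Q")
proof (rule measure_eqI_PiM_finite[OF I, where M="\<lambda>_. borel"])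
  interpret M: prob_space M by fact
  interpret N: prob_space N by fact
  note [measurable] = X Y
  fix A :: "'c \<Rightarrow> real set" assume A: "\<And>i. i \<in> I \<Longrightarrow> A i \<in> sets borel"
  have AP: "Pi\<^sub>E I A \<in> sets (PiM I (\<lambda>_. borel))"
    using A I by (intro sets_PiM_I_finite) auto
  have "measure M {x\<in>space M. \<forall>i\<in>I. X i x \<in> A i} = measure N {x\<in>space N. \<forall>i\<in>I. Y i x \<in> A i}"
  proof (rule measure_rectangle_eqI_iexp[OF I])
    show "(CLINT x|M. iexp (\<Sum>i\<in>I. a i * X i x)) = (CLINT x|N. iexp (\<Sum>i\<in>I. a i * Y i x))" for a
    proof -
      have "(CLINT y|distr M borel (\<lambda>x. \<Sum>i\<in>I. a i * X i x). iexp y) =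
          (CLINT y|distr N borel (\<lambda>x. \<Sum>i\<in>I. a i * Y i x). iexp y)"
        using eq[of a] by simp
      then show ?thesis by (simp add: integral_distr)
    qed
  qed (use A X Y in \<open>auto intro: M.finite_measure_axioms N.finite_measure_axioms\<close>)
  moreover have "(\<lambda>x. \<lambda>i\<in>I. X i x) -` Pi\<^sub>E I A \<inter> space M = {x\<in>space M. \<forall>i\<in>I. X i x \<in> A i}"
    "(\<lambda>x. \<lambda>i\<in>I. Y i x) -` Pi\<^sub>E I A \<inter> space N = {x\<in>space N. \<forall>i\<in>I. Y i x \<in> A i}"
    by (auto simp: PiE_iff)
  ultimately show "emeasure ?P (Pi\<^sub>E I A) = emeasure ?Q (Pi\<^sub>E I A)"
    using AP by (simp add: emeasure_distr M.emeasure_eq_measure N.emeasure_eq_measure)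
next
  interpret M: prob_space M by fact
  note [measurable] = X
  interpret P: prob_space ?P by (rule M.prob_space_distr) measurable
  show "range (\<lambda>n::nat. Pi\<^sub>E I (\<lambda>_. UNIV)) \<subseteq> prod_algebra I (\<lambda>_. borel :: real measure)"
    using I by (auto intro!: prod_algebraI_finite)
  show "(\<Union>n::nat. Pi\<^sub>E I (\<lambda>_. UNIV)) = space (PiM I (\<lambda>_. borel :: real measure))"
    by (simp add: space_PiM)
  show "emeasure ?P (Pi\<^sub>E I (\<lambda>_. UNIV)) \<noteq> \<infinity>" for n :: nat
    using P.emeasure_finite by simp
qed auto

subsection \<open>Gaussian random variables and processes\<close>

text \<open>Identifies the parameters hidden in \<open>gaussian_rv\<close> with the mean and the
  standard deviation. Both cases, degenerate and not, share the same moment formulas, so two moments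
  fix the law.\<close>

lemma gaussian_rv_moments:
  assumes M: "prob_space M" and Y: "gaussian_rv M Y"
  obtains \<mu> \<sigma> where "0 \<le> \<sigma>" "integrable M Y" "integrable M (\<lambda>x. (Y x)\<^sup>2)"
    "(LINT x|M. Y x) = \<mu>" "(LINT x|M. (Y x)\<^sup>2) = \<mu>\<^sup>2 + \<sigma>\<^sup>2"
    "distr M borel Y = (if \<sigma> = 0 then return borel \<mu> else density lborel (normal_density \<mu> \<sigma>))"
proof -
  interpret prob_space M by fact
  have [measurable]: "Y \<in> borel_measurable M" using Y by (simp add: gaussian_rv_def)
  consider (dirac) \<mu> where "distr M borel Y = return borel \<mu>"
    | (normal) \<mu> \<sigma> where "0 < \<sigma>" "distr M borel Y = density lborel (normal_density \<mu> \<sigma>)"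
    using Y unfolding gaussian_rv_def by blast
  then show thesis
  proof cases
    case dirac
    have *: "integrable M (\<lambda>x. f (Y x))" "(LINT x|M. f (Y x)) = f \<mu>"
      if [measurable]: "f \<in> borel_measurable borel" for f :: "real \<Rightarrow> real"
    proof -
      interpret R: prob_space "return borel \<mu>" by (rule prob_space_return) simp
      have "integrable (return borel \<mu>) f"
        by (rule R.integrable_const_bound[where B="\<bar>f \<mu>\<bar>"]) (auto simp: AE_return)
      then show "integrable M (\<lambda>x. f (Y x))"
        by (simp add: integrable_distr_eq flip: dirac)
      have "(LINT y|distr M borel Y. f y) = f \<mu>"
        by (simp add: dirac integral_return)
      then show "(LINT x|M. f (Y x)) = f \<mu>" by (simp add: integral_distr)
    qed
    show thesis
      using that[of 0 \<mu>] *[of "\<lambda>y. y"] *[of "\<lambda>y. y\<^sup>2"] dirac by simp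
  next
    case normal
    have *: "integrable M (\<lambda>x. f (Y x)) \<and> (LINT x|M. f (Y x)) = c"
      if f: "has_bochner_integral lborel (\<lambda>y. normal_density \<mu> \<sigma> y * f y) c"
        and [measurable]: "f \<in> borel_measurable borel" for f :: "real \<Rightarrow> real" and c
    proof -
      have "has_bochner_integral (distr M borel Y) f c"
        unfolding normal using f by (intro has_bochner_integral_density) auto
      then show ?thesis
        by (simp add: has_bochner_integral_iff integrable_distr_eq integral_distr)
    qed
    have 0: "has_bochner_integral lborel (\<lambda>y. normal_density \<mu> \<sigma> y) 1"
      using normal(1) by (simp add: has_bochner_integral_iff)
    have 1: "has_bochner_integral lborel (\<lambda>y. normal_density \<mu> \<sigma> y * y) \<mu>"
      using normal(1) by (rule normal_moment_nz_1)
    have 2: "has_bochner_integral lborel (\<lambda>y. normal_density \<mu> \<sigma> y * (y - \<mu>)\<^sup>2) (\<sigma>\<^sup>2)"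
      using normal_moment_even[OF normal(1), of \<mu> 1] by simp
    \<comment> \<open>Uses y^2 = (y - \<mu>)^2 + 2 \<mu> y - \<mu>^2.\<close>
    have "has_bochner_integral lborel (\<lambda>y. normal_density \<mu> \<sigma> y * (y - \<mu>)\<^sup>2
        + (2 * \<mu> * (normal_density \<mu> \<sigma> y * y) - \<mu>\<^sup>2 * normal_density \<mu> \<sigma> y)) (\<sigma>\<^sup>2 + (2 * \<mu> * \<mu> - \<mu>\<^sup>2 * 1))"
      by (intro has_bochner_integral_add has_bochner_integral_diff has_bochner_integral_mult_right 0 1 2)
    then have "has_bochner_integral lborel (\<lambda>y. normal_density \<mu> \<sigma> y * y\<^sup>2) (\<mu>\<^sup>2 + \<sigma>\<^sup>2)"
      by (simp add: power2_eq_square algebra_simps)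
    then show thesis
      using that[of \<sigma> \<mu>] *[OF 1] *[of "\<lambda>y. y\<^sup>2"] normal by simp
  qed
qed

lemma gaussian_rv_distr_eqI:
  assumes "prob_space M" "gaussian_rv M Y" "prob_space N" "gaussian_rv N Z"
    and "(LINT x|M. Y x) = (LINT x|N. Z x)"
    and "(LINT x|M. (Y x)\<^sup>2) = (LINT x|N. (Z x)\<^sup>2)"
  shows "distr M borel Y = distr N borel Z"
proof -
  obtain \<mu> \<sigma> where 1: "0 \<le> \<sigma>" "(LINT x|M. Y x) = \<mu>" "(LINT x|M. (Y x)\<^sup>2) = \<mu>\<^sup>2 + \<sigma>\<^sup>2"
    "distr M borel Y = (if \<sigma> = 0 then return borel \<mu> else density lborel (normal_density \<mu> \<sigma>))"
    using gaussian_rv_moments[OF assms(1,2)] by metis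
  obtain \<nu> \<tau> where 2: "0 \<le> \<tau>" "(LINT x|N. Z x) = \<nu>" "(LINT x|N. (Z x)\<^sup>2) = \<nu>\<^sup>2 + \<tau>\<^sup>2"
    "distr N borel Z = (if \<tau> = 0 then return borel \<nu> else density lborel (normal_density \<nu> \<tau>))"
    using gaussian_rv_moments[OF assms(3,4)] by metis
  have "\<mu> = \<nu>" "\<sigma> = \<tau>"
    using 1 2 assms(5,6) by (auto intro: power2_eq_imp_eq)
  then show ?thesis using 1 2 by simp
qed

lemma integrable_mult_of_squares:
  fixes f g :: "'a \<Rightarrow> real"
  assumes [measurable]: "f \<in> borel_measurable M" "g \<in> borel_measurable M"
    and "integrable M (\<lambda>x. (f x)\<^sup>2)" "integrable M (\<lambda>x. (g x)\<^sup>2)"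
  shows "integrable M (\<lambda>x. f x * g x)"
proof (rule Bochner_Integration.integrable_bound)
  show "integrable M (\<lambda>x. (f x)\<^sup>2 + (g x)\<^sup>2)" using assms by simp
  have "\<bar>a * b\<bar> \<le> a\<^sup>2 + b\<^sup>2" for a b :: real
  proof -
    have "2 * \<bar>a * b\<bar> \<le> a\<^sup>2 + b\<^sup>2"
      using sum_squares_bound[of "\<bar>a\<bar>" "\<bar>b\<bar>"] by (simp add: abs_mult)
    then show ?thesis using abs_ge_zero[of "a * b"] by linarith
  qed
  then show "AE x in M. norm (f x * g x) \<le> norm ((f x)\<^sup>2 + (g x)\<^sup>2)" by simp
qed measurable

text \<open>By Cramer--Wold, $(U, V)$ and $(U, -V)$ have the same law, so $E[1_A(U) V] = -E[1_A(U) V]$;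
  this replaces the independence of uncorrelated jointly Gaussian variables.\<close>

lemma uncorrelated_gaussian_integral_indicator:
  fixes U V :: "'a \<Rightarrow> real"
  assumes M: "prob_space M"
    and g: "\<And>a b. gaussian_rv M (\<lambda>x. a * U x + b * V x)"
    and U0: "(LINT x|M. U x) = 0" and V0: "(LINT x|M. V x) = 0"
    and UV: "(LINT x|M. U x * V x) = 0"
    and A [measurable]: "A \<in> sets borel"
  shows "(LINT x|M. indicator A (U x) * V x) = 0"
proof -
  have gU: "gaussian_rv M U" and gV: "gaussian_rv M V"
    using g[of 1 0] g[of 0 1] by simp_all
  then have [measurable]: "U \<in> borel_measurable M" "V \<in> borel_measurable M"
    by (simp_all add: gaussian_rv_def)
  have iU: "integrable M U" "integrable M (\<lambda>x. (U x)\<^sup>2)"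
    using gaussian_rv_moments[OF M gU] by metis+
  have iV: "integrable M V" "integrable M (\<lambda>x. (V x)\<^sup>2)"
    using gaussian_rv_moments[OF M gV] by metis+
  have iUV: "integrable M (\<lambda>x. U x * V x)"
    using iU iV by (intro integrable_mult_of_squares) auto
  have mean: "(LINT x|M. a * U x + b * V x) = 0" for a b
    using iU iV U0 V0 by simp
  \<comment> \<open>Without a cross term only b^2 enters, so the law of aU + bV does not notice the
    sign of b.\<close>
  have var: "(LINT x|M. (a * U x + b * V x)\<^sup>2) = a\<^sup>2 * (LINT x|M. (U x)\<^sup>2) + b\<^sup>2 * (LINT x|M. (V x)\<^sup>2)" for a b
  proof -
    have "(LINT x|M. (a * U x + b * V x)\<^sup>2) =
        (LINT x|M. a\<^sup>2 * (U x)\<^sup>2 + (b\<^sup>2 * (V x)\<^sup>2 + (2 * a * b) * (U x * V x)))"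
      by (intro Bochner_Integration.integral_cong) (auto simp: power2_eq_square algebra_simps)
    also have "\<dots> = a\<^sup>2 * (LINT x|M. (U x)\<^sup>2) + b\<^sup>2 * (LINT x|M. (V x)\<^sup>2)"
      using iU iV iUV UV by simp
    finally show ?thesis .
  qed
  \<comment> \<open>The pair (U, cV) as a family indexed by \<open>bool\<close>, to be compared for
    c = 1 and c = -1.\<close>
  define P where "P c i x = (if i then U x else c * V x)" for c :: real and i x
  have P [measurable]: "P c i \<in> borel_measurable M" for c i
    unfolding P_def by (cases i) auto
  have "distr M (PiM UNIV (\<lambda>_. borel)) (\<lambda>x. \<lambda>i\<in>UNIV. P 1 i x) =
      distr M (PiM UNIV (\<lambda>_. borel)) (\<lambda>x. \<lambda>i\<in>UNIV. P (-1) i x)"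
  proof (rule cramer_wold[OF _ M M])
    fix a :: "bool \<Rightarrow> real"
    have "distr M borel (\<lambda>x. a True * U x + a False * V x) = distr M borel (\<lambda>x. a True * U x + (- a False) * V x)"
      by (rule gaussian_rv_distr_eqI[OF M g M g]) (simp_all only: mean var power2_minus)
    then show "distr M borel (\<lambda>x. \<Sum>i\<in>UNIV. a i * P 1 i x) = distr M borel (\<lambda>x. \<Sum>i\<in>UNIV. a i * P (-1) i x)"
      by (simp add: UNIV_bool P_def add.commute)
  qed auto
  then have "(LINT f|distr M (PiM UNIV (\<lambda>_. borel)) (\<lambda>x. \<lambda>i\<in>UNIV. P 1 i x). indicator A (f True) * f False) =
      (LINT f|distr M (PiM UNIV (\<lambda>_. borel)) (\<lambda>x. \<lambda>i\<in>UNIV. P (-1) i x). indicator A (f True) * f False)"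
    by simp
  then have "(LINT x|M. indicator A (U x) * V x) = (LINT x|M. - (indicator A (U x) * V x))"
    by (subst (asm) (1 2) integral_distr) (auto simp: P_def)
  then show ?thesis by simp
qed

text \<open>The positive and negative parts of $h$ define two measures whose images under $Y$ agree,
  hence have the same first moment.\<close>

lemma integral_mult_eq_0_of_indicator:
  fixes Y h :: "'a \<Rightarrow> real"
  assumes [measurable]: "Y \<in> borel_measurable M" and h: "integrable M h"
    and Yh: "integrable M (\<lambda>x. Y x * h x)"
    and zero: "\<And>A. A \<in> sets borel \<Longrightarrow> (LINT x|M. indicator A (Y x) * h x) = 0"
  shows "(LINT x|M. Y x * h x) = 0"
proof -
  have [measurable]: "h \<in> borel_measurable M" using h by auto
  define p where "p x = max 0 (h x)" for x
  define q where "q x = max 0 (- h x)" for x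
  have h_eq: "h x = p x - q x" and pq: "0 \<le> p x" "0 \<le> q x" for x
    by (auto simp: p_def q_def)
  have ip: "integrable M p" "integrable M q"
    unfolding p_def[abs_def] q_def[abs_def] using h by auto
  then have [measurable]: "p \<in> borel_measurable M" "q \<in> borel_measurable M" by auto
  have iYp: "integrable M (\<lambda>x. Y x * p x)"
    by (rule Bochner_Integration.integrable_bound[OF Yh]) (auto simp: p_def abs_mult intro!: mult_left_mono)
  have iYq: "integrable M (\<lambda>x. Y x * q x)"
    by (rule Bochner_Integration.integrable_bound[OF Yh]) (auto simp: q_def abs_mult intro!: mult_left_mono)
  have "distr (density M p) borel Y = distr (density M q) borel Y"
  proof (rule measure_eqI)
    fix A assume "A \<in> sets (distr (density M p) borel Y)"
    then have A [measurable]: "A \<in> sets borel" by simp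
    have ind: "integrable M (\<lambda>x. indicator A (Y x) * k x)" if "integrable M k" for k :: "'a \<Rightarrow> real"
      by (rule Bochner_Integration.integrable_bound[OF that]) (use that in \<open>auto split: split_indicator\<close>)
    have em: "emeasure (distr (density M k) borel Y) A = ennreal (LINT x|M. indicator A (Y x) * k x)"
      if k: "integrable M k" "\<And>x. 0 \<le> k x" for k
    proof -
      have [measurable]: "k \<in> borel_measurable M" using k by auto
      have "emeasure (distr (density M k) borel Y) A = (\<integral>\<^sup>+x. ennreal (indicator A (Y x) * k x) \<partial>M)"
        by (subst emeasure_distr) (auto simp: emeasure_density intro!: nn_integral_cong split: split_indicator)
      also have "\<dots> = ennreal (LINT x|M. indicator A (Y x) * k x)"
        using ind[OF k(1)] k(2) by (intro nn_integral_eq_integral) auto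
      finally show ?thesis .
    qed
    have "(LINT x|M. indicator A (Y x) * p x) = (LINT x|M. indicator A (Y x) * q x)"
      using zero[OF A] ind[OF ip(1)] ind[OF ip(2)] by (simp add: h_eq right_diff_distrib)
    then show "emeasure (distr (density M p) borel Y) A = emeasure (distr (density M q) borel Y) A"
      using em[OF ip(1)] em[OF ip(2)] pq by simp
  qed simp
  then have "(LINT y|distr (density M p) borel Y. y) = (LINT y|distr (density M q) borel Y. y)"
    by simp
  then have "(LINT x|M. Y x * p x) = (LINT x|M. Y x * q x)"
    using pq by (simp add: integral_distr integral_density mult.commute)
  then show ?thesis using iYp iYq by (simp add: h_eq right_diff_distrib)
qed

section \<open>Linear combinations, covariances and equality in law\<close>

lemma gaussian_process_sum:
  assumes "gaussian_process M X" "finite I" "I \<subseteq> {0..}"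
  shows "gaussian_rv M (\<lambda>x. \<Sum>t\<in>I. a t * X t x)"
  using assms by (simp add: gaussian_process_def)

lemma gaussian_process_rv:
  assumes "gaussian_process M X" "0 \<le> t"
  shows "gaussian_rv M (X t)"
  using gaussian_process_sum[OF assms(1), of "{t}" "\<lambda>_. 1"] assms(2) by simp

lemma gaussian_process_measurable:
  "gaussian_process M X \<Longrightarrow> 0 \<le> t \<Longrightarrow> X t \<in> borel_measurable M"
  by (simp add: gaussian_process_def)

lemma gaussian_process_integrable_mult:
  assumes X: "gaussian_process M X" and "0 \<le> s" "0 \<le> t"
  shows "integrable M (\<lambda>x. X s x * X t x)"
proof -
  have "integrable M (\<lambda>x. (X r x)\<^sup>2)" if "0 \<le> r" for r
    using gaussian_rv_moments[OF _ gaussian_process_rv[OF X that]] X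
    unfolding gaussian_process_def by metis
  then show ?thesis
    using gaussian_process_measurable[OF X] assms(2,3) by (intro integrable_mult_of_squares) auto
qed

lemma covariance_fn_sym: "covariance_fn M X s t = covariance_fn M X t s"
  by (simp add: covariance_fn_def mult.commute)

lemma gaussian_process_sum_mean:
  assumes "centered M X" "I \<subseteq> {0..}"
  shows "(LINT x|M. (\<Sum>t\<in>I. a t * X t x)) = 0"
  using assms by (subst Bochner_Integration.integral_sum) (auto simp: centered_def subset_eq)

lemma gaussian_process_sum_second_moment:
  assumes X: "gaussian_process M X" and I: "I \<subseteq> {0..}"
  shows "(LINT x|M. (\<Sum>t\<in>I. a t * X t x)\<^sup>2) = (\<Sum>s\<in>I. \<Sum>t\<in>I. a s * a t * covariance_fn M X s t)"
proof -
  have i: "integrable M (\<lambda>x. a s * a t * (X s x * X t x))" if "s \<in> I" "t \<in> I" for s t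
    using gaussian_process_integrable_mult[OF X, of s t] that I by (auto simp: subset_eq)
  have "(LINT x|M. (\<Sum>t\<in>I. a t * X t x)\<^sup>2) = (LINT x|M. (\<Sum>s\<in>I. \<Sum>t\<in>I. a s * a t * (X s x * X t x)))"
    by (simp add: power2_eq_square sum_product mult_ac)
  also have "\<dots> = (\<Sum>s\<in>I. LINT x|M. (\<Sum>t\<in>I. a s * a t * (X s x * X t x)))"
    using i by (intro Bochner_Integration.integral_sum Bochner_Integration.integrable_sum)
  also have "\<dots> = (\<Sum>s\<in>I. \<Sum>t\<in>I. LINT x|M. a s * a t * (X s x * X t x))"
    using i by (intro sum.cong refl Bochner_Integration.integral_sum)
  finally show ?thesis by (simp add: covariance_fn_def)
qed

text \<open>Each linear combination is a centered Gaussian variable whose second moment is the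
  quadratic form of the covariance, so its law is the same for both processes.\<close>

lemma same_law_eqI_covariance:
  assumes X: "gaussian_process M X" "centered M X"
    and Y: "gaussian_process N Y" "centered N Y"
    and cov: "\<And>s t. 0 \<le> s \<Longrightarrow> 0 \<le> t \<Longrightarrow> covariance_fn M X s t = covariance_fn N Y s t"
  shows "same_law M X N Y"
  unfolding same_law_def fdd_def
proof (intro allI impI)
  fix I :: "real set" assume "finite I \<and> I \<subseteq> {0..}"
  then have fin: "finite I" and I: "I \<subseteq> {0..}" by auto
  show "distr M (PiM I (\<lambda>_. borel)) (\<lambda>\<omega>. \<lambda>t\<in>I. X t \<omega>) = distr N (PiM I (\<lambda>_. borel)) (\<lambda>\<omega>. \<lambda>t\<in>I. Y t \<omega>)"
  proof (rule cramer_wold[OF fin])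
    show "prob_space M" "prob_space N" using X Y by (simp_all add: gaussian_process_def)
    show "X t \<in> borel_measurable M" "Y t \<in> borel_measurable N" if "t \<in> I" for t
      using that I X Y by (auto simp: gaussian_process_def subset_eq)
    fix a
    show "distr M borel (\<lambda>x. \<Sum>t\<in>I. a t * X t x) = distr N borel (\<lambda>x. \<Sum>t\<in>I. a t * Y t x)"
    proof (rule gaussian_rv_distr_eqI)
      show "prob_space M" "prob_space N" using X Y by (simp_all add: gaussian_process_def)
      show "gaussian_rv M (\<lambda>x. \<Sum>t\<in>I. a t * X t x)" "gaussian_rv N (\<lambda>x. \<Sum>t\<in>I. a t * Y t x)"
        using X Y fin I by (auto intro: gaussian_process_sum)
      show "(LINT x|M. (\<Sum>t\<in>I. a t * X t x)) = (LINT x|N. (\<Sum>t\<in>I. a t * Y t x))"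
        using gaussian_process_sum_mean[OF X(2) I] gaussian_process_sum_mean[OF Y(2) I] by simp
      show "(LINT x|M. (\<Sum>t\<in>I. a t * X t x)\<^sup>2) = (LINT x|N. (\<Sum>t\<in>I. a t * Y t x)\<^sup>2)"
        unfolding gaussian_process_sum_second_moment[OF X(1) I] gaussian_process_sum_second_moment[OF Y(1) I]
        using I cov by (intro sum.cong refl) (auto simp: subset_eq)
    qed
  qed
qed

subsection \<open>The Markov property\<close>

text \<open>Serves both \<open>nat_filtration\<close>, with an interval of times, and
  \<open>gen_by\<close>, with a one-point index set.\<close>

lemma sigma_vimage_subalgebra:
  assumes "\<And>i. i \<in> I \<Longrightarrow> X i \<in> borel_measurable M"
  shows "subalgebra M (sigma (space M) (\<Union>i\<in>I. {X i -` A \<inter> space M | A. A \<in> sets borel}))"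
proof -
  have "sets (sigma (space M) (\<Union>i\<in>I. {X i -` A \<inter> space M | A. A \<in> sets borel})) \<subseteq> sets M"
    using assms by (auto intro!: sets.sigma_sets_subset measurable_sets simp: sets_measure_of_conv)
  then show ?thesis by (simp add: subalgebra_def space_measure_of_conv)
qed

lemma measurable_sigma_vimage:
  assumes "i \<in> I"
  shows "X i \<in> measurable (sigma (space M) (\<Union>i\<in>I. {X i -` A \<inter> space M | A. A \<in> sets borel})) borel"
proof (rule measurableI)
  fix A :: "'c set" assume "A \<in> sets borel"
  then have "X i -` A \<inter> space M \<in> (\<Union>i\<in>I. {X i -` A \<inter> space M | A. A \<in> sets borel})"
    using assms by blast
  moreover have "(\<Union>i\<in>I. {X i -` A \<inter> space M | A. A \<in> sets borel}) \<subseteq> Pow (space M)" by blast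
  ultimately show "X i -` A \<inter> space (sigma (space M) (\<Union>i\<in>I. {X i -` A \<inter> space M | A. A \<in> sets borel}))
      \<in> sets (sigma (space M) (\<Union>i\<in>I. {X i -` A \<inter> space M | A. A \<in> sets borel}))"
    by (simp add: space_measure_of_conv in_measure_of)
qed simp

lemma subalgebra_gen_by:
  assumes "Y \<in> borel_measurable M"
  shows "subalgebra M (gen_by M Y)"
  using sigma_vimage_subalgebra[of "{()}" "\<lambda>_. Y" M] assms by (simp add: gen_by_def)

text \<open>The preimages of Borel sets under one map already form a sigma-algebra, so generating
  adds no events.\<close>

lemma sets_gen_by:
  assumes "B \<in> sets (gen_by M Y)"
  obtains A where "A \<in> sets borel" "B = Y -` A \<inter> space M"
proof -
  have "sets (gen_by M Y) = sets (vimage_algebra (space M) Y borel)"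
    by (auto simp: gen_by_def sets_vimage_algebra sets_measure_of_conv)
  then show thesis using assms that by (auto simp: sets_vimage_algebra2)
qed

lemma markov_covariance:
  assumes X: "gaussian_process M X" "centered M X" and markov: "markov_process M X"
    and st: "0 \<le> s" "s < t" "t \<le> u"
  shows "covariance_fn M X s u * covariance_fn M X t t = covariance_fn M X s t * covariance_fn M X t u"
proof (cases "covariance_fn M X t t = 0")
  case True
  \<comment> \<open>Here the regression coefficient is undefined, but X_t vanishes almost surely and
    both sides are 0.\<close>
  have "AE x in M. (X t x)\<^sup>2 = 0"
    using True st gaussian_process_integrable_mult[OF X(1), of t t]
    by (subst integral_nonneg_eq_0_iff_AE[symmetric]) (auto simp: covariance_fn_def power2_eq_square)
  then have "AE x in M. X s x * X t x = 0" by eventually_elim simp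
  then have "covariance_fn M X s t = 0"
    unfolding covariance_fn_def by (rule integral_eq_zero_AE)
  then show ?thesis using True by simp
next
  case False
  interpret prob_space M using X by (simp add: gaussian_process_def)
  have t: "0 \<le> t" and u: "0 \<le> u" using st by auto
  note [measurable] = gaussian_process_measurable[OF X(1) st(1)]
    gaussian_process_measurable[OF X(1) t] gaussian_process_measurable[OF X(1) u]
  have int: "integrable M (X r)" if "0 \<le> r" for r
    using X(2) that by (simp add: centered_def)
  have mean: "(LINT x|M. X r x) = 0" if "0 \<le> r" for r
    using X(2) that by (simp add: centered_def)
  note int2 = gaussian_process_integrable_mult[OF X(1)]
  define \<gamma> where "\<gamma> = covariance_fn M X s t / covariance_fn M X t t"
  define V where "V x = X s x - \<gamma> * X t x" for x
  have V [measurable]: "V \<in> borel_measurable M" unfolding V_def by measurable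
  have iV: "integrable M V" unfolding V_def using int st t by simp
  have prod_V: "integrable M (\<lambda>x. X r x * V x)"
    "(LINT x|M. X r x * V x) = covariance_fn M X s r - \<gamma> * covariance_fn M X t r" if "0 \<le> r" for r
  proof -
    have *: "X r x * V x = X s x * X r x - \<gamma> * (X t x * X r x)" for x
      by (simp add: V_def algebra_simps)
    show "integrable M (\<lambda>x. X r x * V x)"
      "(LINT x|M. X r x * V x) = covariance_fn M X s r - \<gamma> * covariance_fn M X t r"
      unfolding * covariance_fn_def using int2 st t that by simp_all
  qed
  have V_ind: "(LINT x|M. indicator A (X t x) * V x) = 0" if "A \<in> sets borel" for A
  proof (rule uncorrelated_gaussian_integral_indicator[OF prob_space_axioms])
    fix a b
    \<comment> \<open>From aX_t + bV = bX_s + (a - b\<gamma>)X_t. Since s < t, the two coefficients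
      belong to distinct indices.\<close>
    define c where "c r = (if r = s then b else a - b * \<gamma>)" for r
    have "gaussian_rv M (\<lambda>x. \<Sum>r\<in>{s, t}. c r * X r x)"
      using st t by (intro gaussian_process_sum[OF X(1)]) auto
    moreover have "(\<Sum>r\<in>{s, t}. c r * X r x) = a * X t x + b * V x" for x
      using st by (simp add: c_def V_def algebra_simps)
    ultimately show "gaussian_rv M (\<lambda>x. a * X t x + b * V x)" by (simp only:)
  next
    show "(LINT x|M. V x) = 0" unfolding V_def using int mean st t by simp
    show "(LINT x|M. X t x * V x) = 0" using prod_V(2)[OF t] False by (simp add: \<gamma>_def)
  qed (use mean t that in auto)
  define F where "F = nat_filtration M X t"
  define G where "G = gen_by M (X t)"
  have sub: "subalgebra M F" "subalgebra M G"
    unfolding F_def G_def nat_filtration_def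
    using st by (auto intro!: sigma_vimage_subalgebra subalgebra_gen_by gaussian_process_measurable[OF X(1)])
  interpret F: finite_measure_subalgebra M F by unfold_locales (rule sub)
  interpret G: finite_measure_subalgebra M G by unfold_locales (rule sub)
  have [measurable]: "X s \<in> borel_measurable F" "X t \<in> borel_measurable F"
    unfolding F_def nat_filtration_def using st by (auto intro!: measurable_sigma_vimage)
  have VF [measurable]: "V \<in> borel_measurable F" unfolding V_def by measurable
  have condV: "AE x in M. real_cond_exp M G V x = 0"
  proof (rule G.real_cond_exp_charact)
    fix B assume "B \<in> sets G"
    then obtain A where A: "A \<in> sets borel" "B = X t -` A \<inter> space M"
      unfolding G_def by (rule sets_gen_by)
    have "(LINT x:B|M. V x) = (LINT x|M. indicator A (X t x) * V x)"
      unfolding set_lebesgue_integral_def A(2)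
      by (intro Bochner_Integration.integral_cong) (auto split: split_indicator)
    then show "(LINT x:B|M. V x) = (LINT x:B|M. 0)" using V_ind[OF A(1)] by simp
  qed (use iV in auto)
  \<comment> \<open>For an indicator of X_u: V is \<open>F\<close>-measurable, so the indicator may
    be replaced by its conditional expectation given \<open>F\<close>. By the Markov property this
    is the \<open>G\<close>-measurable k, which lets V be replaced by its conditional expectation
    given \<open>G\<close>, namely 0.\<close>
  have "(LINT x|M. X u x * V x) = 0"
  proof (rule integral_mult_eq_0_of_indicator)
    fix A :: "real set" assume A [measurable]: "A \<in> sets borel"
    define k where "k = real_cond_exp M G (\<lambda>x. indicator A (X u x))"
    have k [measurable]: "k \<in> borel_measurable G" "k \<in> borel_measurable M"
      unfolding k_def by auto
    have "integrable M (\<lambda>x. indicator A (X u x) * V x)"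
      by (rule Bochner_Integration.integrable_bound[OF iV]) (auto split: split_indicator)
    then have i: "integrable M (\<lambda>x. V x * indicator A (X u x))" by (simp add: mult.commute)
    have m: "(\<lambda>x. indicat_real A (X u x)) \<in> borel_measurable M" by measurable
    have ae: "AE x in M. real_cond_exp M F (\<lambda>x. indicator A (X u x)) x = k x"
      using markov t st A unfolding markov_process_def F_def G_def k_def by blast
    have ae': "AE x in M. V x * real_cond_exp M F (\<lambda>x. indicator A (X u x)) x = V x * k x"
      using ae by eventually_elim simp
    \<comment> \<open>Integrability is inherited from the product of V with the
      \<open>F\<close>-conditional expectation through almost sure equality.\<close>
    have ik: "integrable M (\<lambda>x. k x * V x)"
      using F.real_cond_exp_intg(1)[OF i VF m] ae'
      by (subst mult.commute, subst (asm) integrable_cong_AE) auto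
    have "(LINT x|M. indicator A (X u x) * V x) = (LINT x|M. V x * indicator A (X u x))"
      by (simp add: mult.commute)
    also have "\<dots> = (LINT x|M. V x * real_cond_exp M F (\<lambda>x. indicator A (X u x)) x)"
      using F.real_cond_exp_intg(2)[OF i VF m] by simp
    also have "\<dots> = (LINT x|M. V x * k x)"
      using ae' by (intro integral_cong_AE) auto
    also have "\<dots> = (LINT x|M. k x * V x)"
      by (simp add: mult.commute)
    also have "\<dots> = (LINT x|M. k x * real_cond_exp M G V x)"
      using G.real_cond_exp_intg(2)[OF ik k(1) V] by simp
    also have "\<dots> = 0"
      using condV by (intro integral_eq_zero_AE) auto
    finally show "(LINT x|M. indicator A (X u x) * V x) = 0" .
  qed (use iV prod_V(1)[OF u] in auto)
  then show ?thesis using prod_V(2)[OF u] False by (simp add: \<gamma>_def field_simps)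
qed

subsection \<open>Self-similar Gaussian Markov processes\<close>

lemma gaussian_process_scale:
  assumes "gaussian_process M X"
  shows "gaussian_process M (\<lambda>t x. c * X t x)"
  unfolding gaussian_process_def
proof (intro conjI allI impI)
  show "prob_space M" using assms by (simp add: gaussian_process_def)
  show "(\<lambda>x. c * X t x) \<in> borel_measurable M" if "0 \<le> t" for t
    using gaussian_process_measurable[OF assms that] by measurable
  fix I a assume "finite I \<and> I \<subseteq> {0::real..}"
  then show "gaussian_rv M (\<lambda>x. \<Sum>t\<in>I. a t * (c * X t x))"
    using gaussian_process_sum[OF assms, of I "\<lambda>t. a t * c"] by (simp add: mult.assoc)
qed

lemma covariance_fn_scale:
  "covariance_fn M (\<lambda>t x. c * X t x) s t = c\<^sup>2 * covariance_fn M X s t"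
proof -
  have "covariance_fn M (\<lambda>t x. c * X t x) s t = (LINT x|M. c\<^sup>2 * (X s x * X t x))"
    by (simp add: covariance_fn_def power2_eq_square mult_ac)
  then show ?thesis by (simp add: covariance_fn_def)
qed

text \<open>The covariance is the integral of \<open>f s * f t\<close> under the finite-dimensional
  law at {s, t}, also when s = t.\<close>

lemma same_law_covariance:
  assumes "same_law M X N Y" and st: "0 \<le> s" "0 \<le> t"
    and X: "\<And>t. 0 \<le> t \<Longrightarrow> X t \<in> borel_measurable M"
    and Y: "\<And>t. 0 \<le> t \<Longrightarrow> Y t \<in> borel_measurable N"
  shows "covariance_fn M X s t = covariance_fn N Y s t"
proof -
  have m: "(\<lambda>x. \<lambda>t\<in>{s, t}. Z t x) \<in> measurable K (PiM {s, t} (\<lambda>_. borel))"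
    if "\<And>t. 0 \<le> t \<Longrightarrow> Z t \<in> borel_measurable K" for Z :: "real \<Rightarrow> 'c \<Rightarrow> real" and K
    using that st by (intro measurable_restrict) auto
  have f: "(\<lambda>f. f s * f t) \<in> borel_measurable (PiM {s, t} (\<lambda>_. borel :: real measure))"
    by (intro borel_measurable_times measurable_component_singleton) auto
  have "fdd M X {s, t} = fdd N Y {s, t}"
    using assms(1) st by (simp add: same_law_def)
  then have "(LINT f|fdd M X {s, t}. f s * f t) = (LINT f|fdd N Y {s, t}. f s * f t)"
    by simp
  then show ?thesis
    using integral_distr[OF m[of X M] f] integral_distr[OF m[of Y N] f] X Y
    by (simp add: fdd_def covariance_fn_def)
qed

lemma covariance_fn_diag_nonneg: "0 \<le> covariance_fn M X t t"
  by (simp add: covariance_fn_def)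

lemma covariance_fn_cauchy_schwarz:
  assumes X: "gaussian_process M X" and st: "0 \<le> s" "0 \<le> t"
  shows "(covariance_fn M X s t)\<^sup>2 \<le> covariance_fn M X s s * covariance_fn M X t t"
proof -
  define A B C where "A = covariance_fn M X s s" and "B = covariance_fn M X s t"
    and "C = covariance_fn M X t t"
  have q: "0 \<le> x\<^sup>2 * A + 2 * x * y * B + y\<^sup>2 * C" for x y
  proof -
    have "0 \<le> (LINT \<omega>|M. (x * X s \<omega> + y * X t \<omega>)\<^sup>2)" by simp
    also have "\<dots> = (LINT \<omega>|M. x\<^sup>2 * (X s \<omega> * X s \<omega>) + (2 * x * y * (X s \<omega> * X t \<omega>) + y\<^sup>2 * (X t \<omega> * X t \<omega>)))"
      by (intro Bochner_Integration.integral_cong) (auto simp: power2_eq_square algebra_simps)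
    also have "\<dots> = x\<^sup>2 * A + (2 * x * y * B + y\<^sup>2 * C)"
      using gaussian_process_integrable_mult[OF X] st by (simp add: A_def B_def C_def covariance_fn_def)
    finally show ?thesis by simp
  qed
  \<comment> \<open>The quadratic form at (C, -B) and (B, -A) has AC - B^2 as a factor, which
    settles every case but A = C = 0. There the point (1, -B) gives -2B^2 \<ge> 0.\<close>
  have "0 \<le> C * (A * C - B\<^sup>2)" "0 \<le> A * (A * C - B\<^sup>2)" "0 \<le> A" "0 \<le> C"
    using q[of C "- B"] q[of B "- A"] q[of 1 0] q[of 0 1] by (auto simp: power2_eq_square algebra_simps)
  moreover have "B = 0" if "A = 0" "C = 0"
    using q[of 1 "- B"] that by (auto simp: power2_eq_square mult_le_0_iff)
  ultimately have "B\<^sup>2 \<le> A * C"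
    by (smt (verit) mult_nonneg_nonneg zero_le_mult_iff power2_eq_square mult_zero_left)
  then show ?thesis by (simp add: A_def B_def C_def)
qed

lemma self_similar_covariance:
  assumes X: "gaussian_process M X" and ss: "self_similar M H X"
    and "0 < a" "0 \<le> s" "0 \<le> t"
  shows "covariance_fn M X (a * s) (a * t) = a powr (2 * H) * covariance_fn M X s t"
proof -
  have "same_law M (\<lambda>t. X (a * t)) M (\<lambda>t \<omega>. a powr H * X t \<omega>)"
    using ss \<open>0 < a\<close> by (simp add: self_similar_def)
  then have "covariance_fn M (\<lambda>t. X (a * t)) s t = covariance_fn M (\<lambda>t \<omega>. a powr H * X t \<omega>) s t"
    using assms gaussian_process_measurable[OF X] by (intro same_law_covariance) auto
  also have "\<dots> = a powr (2 * H) * covariance_fn M X s t"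
    by (simp add: covariance_fn_scale power2_eq_square flip: powr_add)
  finally show ?thesis by (simp add: covariance_fn_def)
qed

lemma self_similar_markov_covariance:
  assumes H: "0 < H" and X: "gaussian_process M X" "centered M X"
    and ss: "self_similar M H X" and markov: "markov_process M X"
  obtains c :: ereal where "c \<le> - ereal H"
    "\<And>s t. 0 \<le> s \<Longrightarrow> 0 \<le> t \<Longrightarrow> covariance_fn M X s t = covariance_fn M X 1 1 * R_Hc H c s t"
proof -
  note result = that
  define R where "R = covariance_fn M X"
  have sym: "R s t = R t s" for s t
    unfolding R_def by (rule covariance_fn_sym)
  have scale: "R (a * s) (a * t) = a powr (2 * H) * R s t" if "0 < a" "0 \<le> s" "0 \<le> t" for a s t
    unfolding R_def using self_similar_covariance[OF X(1) ss that] .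
  have CS: "(R s t)\<^sup>2 \<le> R s s * R t t" if "0 \<le> s" "0 \<le> t" for s t
    unfolding R_def using covariance_fn_cauchy_schwarz[OF X(1) that] .
  \<comment> \<open>Scaling fixes the time 0 but multiplies R(0, 0) by 2^(2H) > 1.\<close>
  have "R 0 0 = 0"
  proof -
    have "(2::real) powr (2 * H) > 1" using H by (intro gr_one_powr) auto
    then show ?thesis using scale[of 2 0 0] by auto
  qed
  then have zero: "R s t = 0" if "0 \<le> s" "0 \<le> t" "s = 0 \<or> t = 0" for s t
    using CS[of s t] that by auto
  have diag: "R t t = t powr (2 * H) * R 1 1" if "0 \<le> t" for t
    using scale[of t 1 1] zero[of 0 0] that by (cases "t = 0") auto
  have concl: thesis
    if c: "c \<le> - ereal H"
      and eq: "\<And>s t. 0 < s \<Longrightarrow> s \<le> t \<Longrightarrow> R s t = R 1 1 * R_Hc H c s t" for c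
  proof (rule result[OF c])
    fix s t :: real assume st: "0 \<le> s" "0 \<le> t"
    have Rc_sym: "R_Hc H c s t = R_Hc H c t s" for s t
      by (auto simp: R_Hc_def max.commute min.commute)
    have "R s t = R 1 1 * R_Hc H c s t"
    proof (cases "s = 0 \<or> t = 0")
      case True
      \<comment> \<open>For c = -\<infinity> and s = t = 0 this relies on
        \<open>0 powr (2 * H) = 0\<close>.\<close>
      then show ?thesis using zero[OF st] st by (auto simp: R_Hc_def)
    next
      case False
      then show ?thesis
        using eq[of s t] eq[of t s] sym[of s t] Rc_sym[of s t] st by (cases "s \<le> t") auto
    qed
    then show "covariance_fn M X s t = covariance_fn M X 1 1 * R_Hc H c s t" by (simp add: R_def)
  qed
  define \<rho> where "\<rho> x = R 1 x / R 1 1" for x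
  have nonneg: "0 \<le> R 1 1" unfolding R_def by (rule covariance_fn_diag_nonneg)
  have R_\<rho>: "R s t = R 1 1 * (s powr (2 * H) * \<rho> (t / s))" if "0 < s" "s \<le> t" "R 1 1 \<noteq> 0" for s t
    using scale[of s 1 "t / s"] that by (simp add: \<rho>_def)
  show thesis
  proof (cases "R 1 1 = 0")
    case True
    \<comment> \<open>The covariance vanishes identically, so any admissible c would do.\<close>
    have "R s t = 0" if "0 < s" "s \<le> t" for s t
      using CS[of s t] diag[of s] that True by simp
    then show thesis using concl[of "-\<infinity>"] True by simp
  next
    case False
    then have pos: "0 < R 1 1" using nonneg by simp
    have \<rho>1: "\<rho> 1 = 1" using False by (simp add: \<rho>_def)
    have mult: "\<rho> (x * y) = \<rho> x * \<rho> y" if xy: "1 \<le> x" "1 \<le> y" for x y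
    \<comment> \<open>The Markov identity is applied at the times 1, x and xy, and its first
      inequality is strict.\<close>
    proof (cases "x = 1")
      case True
      then show ?thesis using \<rho>1 by simp
    next
      case x: False
      then have "R 1 (x * y) * R x x = R 1 x * R x (x * y)"
        unfolding R_def using xy by (intro markov_covariance[OF X markov]) auto
      moreover have "R x (x * y) = x powr (2 * H) * R 1 y"
        using scale[of x 1 y] xy by simp
      moreover have "x powr (2 * H) \<noteq> 0" using xy by simp
      ultimately show ?thesis
        using diag[of x] xy False by (simp add: \<rho>_def field_simps)
    qed
    have \<rho>_nonneg: "0 \<le> \<rho> x" if "1 \<le> x" for x
      using mult[of "sqrt x" "sqrt x"] that by simp
    have \<rho>_le: "\<rho> x \<le> x powr H" if "1 \<le> x" for x
    proof (rule power2_le_imp_le)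
      have "(R 1 x)\<^sup>2 \<le> x powr (2 * H) * (R 1 1)\<^sup>2"
        using CS[of 1 x] diag[of x] that by (simp add: power2_eq_square mult_ac)
      then have "(\<rho> x)\<^sup>2 \<le> x powr (2 * H)"
        using pos by (simp add: \<rho>_def power_divide divide_le_eq)
      also have "\<dots> = (x powr H)\<^sup>2"
        by (simp add: power2_eq_square flip: powr_add)
      finally show "(\<rho> x)\<^sup>2 \<le> (x powr H)\<^sup>2" .
    qed simp
    show thesis
    proof (cases "\<exists>x\<ge>1. \<rho> x = 0")
      case True
      then obtain z where z: "1 \<le> z" "\<rho> z = 0" by blast
      \<comment> \<open>One zero z spreads: some power x^n exceeds z, so \<rho>(x)^n = \<rho>(x^n)
        has the factor \<rho>(z) = 0.\<close>
      have vanish: "\<rho> x = 0" if x: "1 < x" for x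
      proof -
        obtain n where n: "z < x ^ n" using real_arch_pow[OF x] by blast
        have "\<rho> (x ^ k) = \<rho> x ^ k" for k
        proof (induction k)
          case (Suc k)
          then show ?case using mult[of x "x ^ k"] x by simp
        qed (simp add: \<rho>1)
        moreover have "\<rho> (x ^ n) = \<rho> z * \<rho> (x ^ n / z)"
          using mult[of z "x ^ n / z"] z n by (simp add: divide_simps)
        ultimately show ?thesis using z by simp
      qed
      show thesis
      proof (rule concl[of "-\<infinity>"])
        fix s t :: real assume "0 < s" "s \<le> t"
        then show "R s t = R 1 1 * R_Hc H (-\<infinity>) s t"
          using R_\<rho>[of s t] vanish[of "t / s"] \<rho>1 False by (cases "s = t") (auto simp: R_Hc_def)
      qed simp
    next
      case no_zero: False
      have "0 < \<rho> x" if "1 \<le> x" for x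
        using \<rho>_nonneg[OF that] no_zero that by force
      from multiplicative_eq_powr[OF mult this \<rho>_le]
      obtain k where k: "k \<le> H" "\<And>x. 1 \<le> x \<Longrightarrow> \<rho> x = x powr k" by blast
      show thesis
      \<comment> \<open>In s^(2H) (t/s)^k the larger time has exponent k = 2H + c and the smaller
        one 2H - k = -c.\<close>
      proof (rule concl[of "ereal (k - 2 * H)"])
        fix s t :: real assume st: "0 < s" "s \<le> t"
        then have "s powr (2 * H) * \<rho> (t / s) = t powr k * s powr (2 * H - k)"
          using k(2)[of "t / s"] by (simp add: powr_divide powr_diff)
        then show "R s t = R 1 1 * R_Hc H (ereal (k - 2 * H)) s t"
          using R_\<rho>[OF st False] st by (simp add: R_Hc_def max_def min_def)
      qed (use k in simp)
    qed
  qed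
qed

text \<open>The process X^{H,c} enters as an arbitrary centered Gaussian process with covariance
  \<open>R_Hc H c\<close>, on any probability space over the type \<open>'b\<close>, so no
  particular construction is singled out.\<close>

theorem theorem1:
  fixes M :: "'a measure" and X :: "real \<Rightarrow> 'a \<Rightarrow> real" and H :: real
  assumes "H > 0"
    and "gaussian_process M X"
    and "centered M X"
    and "self_similar M H X"
    and "markov_process M X"
  shows "\<exists>c::ereal. c \<le> - ereal H \<and> covariance_fn M X 1 1 \<ge> 0 \<and>
     (\<forall>s t. s \<ge> 0 \<longrightarrow> t \<ge> 0 \<longrightarrow>
        covariance_fn M X s t = covariance_fn M X 1 1 * R_Hc H c s t) \<and>
     (\<forall>(N :: 'b measure) Y. gaussian_process N Y \<and> centered N Y \<and>
        (\<forall>s t. s \<ge> 0 \<longrightarrow> t \<ge> 0 \<longrightarrow> covariance_fn N Y s t = R_Hc H c s t) \<longrightarrow>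
        same_law M X N (\<lambda>t \<omega>. sqrt (covariance_fn M X 1 1) * Y t \<omega>))"
proof -
  obtain c where c: "c \<le> - ereal H"
    "\<And>s t. 0 \<le> s \<Longrightarrow> 0 \<le> t \<Longrightarrow> covariance_fn M X s t = covariance_fn M X 1 1 * R_Hc H c s t"
    using self_similar_markov_covariance[OF assms] by blast
  have "same_law M X N (\<lambda>t \<omega>. sqrt (covariance_fn M X 1 1) * Y t \<omega>)"
    if Y: "gaussian_process N Y" "centered N Y"
      and cov: "\<And>s t. 0 \<le> s \<Longrightarrow> 0 \<le> t \<Longrightarrow> covariance_fn N Y s t = R_Hc H c s t"
    for N :: "'b measure" and Y
  proof (rule same_law_eqI_covariance[OF assms(2,3)])
    show "centered N (\<lambda>t \<omega>. sqrt (covariance_fn M X 1 1) * Y t \<omega>)"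
      using Y(2) by (simp add: centered_def)
    \<comment> \<open>Scaling by the square root multiplies the covariance by its square, which is
      R(1, 1) because R(1, 1) \<ge> 0.\<close>
    show "covariance_fn M X s t = covariance_fn N (\<lambda>t \<omega>. sqrt (covariance_fn M X 1 1) * Y t \<omega>) s t"
      if "0 \<le> s" "0 \<le> t" for s t
      using cov[OF that] c(2)[OF that] covariance_fn_diag_nonneg[of M X 1]
      by (simp add: covariance_fn_scale)
  qed (rule gaussian_process_scale[OF Y(1)])
  then show ?thesis using c covariance_fn_diag_nonneg[of M X 1] by blast
qed

end
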